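(* Let $n,m \ge 1$, let $\omega=e^{2\pi i/m}$, and let $\mathcal H^m_{2n-1}$ be the complex hyperplane arrangement in $\mathbb C^{2n}$ (coordinates $x_1,\dots,x_n,y_1,\dots,y_n$) $$\mathcal H^m_{2n-1} = \{x_i - \omega^{\ell}x_j = y_i : 1\leq i < j \leq n,\ 0\leq \ell < m\} \cup \{x_i = y_i : 1\le i \le n\}.$$ Then the intersection lattice $\mathcal L(\mathcal H^m_{2n-1})$ is isomorphic to the induced subposet $\mathcal L_{2n-1}^m$ of the Dowling lattice $Q_{2n-1}(\mathbb Z_m)$ consisting of all labeled partitions $B_0|B_1|\cdots|B_k$ such that: if $B_0\ne\{0\}$ then $\min(B_0\setminus\{0\})$ is odd; and for every nonsingleton $B_i$ with $i>0$, $\min(B_i)$ is odd and $\max(B_i)$ is even.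
   Context: $\mathcal L(\mathcal A)$ is the intersection lattice of an arrangement (nonempty intersections of hyperplanes ordered by reverse inclusion). The Dowling lattice $Q_N(\mathbb Z_m)$ consists of labeled partitions $B_0|B_1|\cdots|B_k$ of $\{0\}\cup[N]$ such that $0\in B_0$ (the zero block, whose elements are unlabeled) and the elements of each $B_i$, $i\ge1$, are labeled by elements of $\{0,1,\dots,m-1\}$ with $\min(B_i)$ labeled $0$. The partial order is generated by the following cover relations (merging two blocks): merging $B_0$ with $B_i$ erases the labels of $B_i$ and forms the new zero block $B_0\cup B_i$; for $i,j\ne0$ with $\min(B_i)<\min(B_j)$, there are $m$ ways to merge $B_i$ and $B_j$: for each $\ell\in\{0,\dots,m-1\}$ the labels of $B_i$ are kept and $\ell$ is added modulo $m$ to each label of $B_j$, and the union is formed. *)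

theory Defs
  imports Complex_Main "HOL-Library.Disjoint_Sets" "HOL-Algebra.Order"
    "Jordan_Normal_Form.Matrix"
begin

section \<open>Posets\<close>

definition poset_isomorphic :: "'a gorder \<Rightarrow> 'b gorder \<Rightarrow> bool" where
  "poset_isomorphic A B \<longleftrightarrow>
     partial_order A \<and> partial_order B \<and>
     (\<exists>f. bij_betw f (carrier A) (carrier B) \<and> order_emb A B f)"


section \<open>The intersection lattice of an arrangement\<close>

text \<open>
  An arrangement in the ambient space \<open>V\<close> is given by the set \<open>A\<close> of its hyperplanes. The case
  \<open>S = {}\<close> contributes \<open>V\<close> itself, the bottom element.
\<close>

definition intersection_lattice :: "'a set \<Rightarrow> 'a set set \<Rightarrow> 'a set gorder" where
  "intersection_lattice V A =
     \<lparr>carrier = {X. X \<noteq> {} \<and> (\<exists>S \<subseteq> A. X = V \<inter> \<Inter>S)}, eq = (=), le = (\<lambda>X Y. Y \<subseteq> X)\<rparr>"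

lemma partial_order_intersection_lattice: "partial_order (intersection_lattice V A)"
  by unfold_locales (auto simp: intersection_lattice_def)

text \<open>
  Vectors are indexed from 0: for \<open>1 \<le> i \<le> n\<close> the coordinates \<open>x\<^sub>i\<close> and \<open>y\<^sub>i\<close> of a point
  of \<open>\<complex>\<close>-space of dimension \<open>2 * n\<close> are its components number \<open>i - 1\<close> and \<open>n + i - 1\<close>.
\<close>

definition x_coord :: "complex vec \<Rightarrow> nat \<Rightarrow> complex" where
  "x_coord v i = v $ (i - 1)"

definition y_coord :: "nat \<Rightarrow> complex vec \<Rightarrow> nat \<Rightarrow> complex" where
  "y_coord n v i = v $ (n + i - 1)"

text \<open>The arrangement written \<open>\<H>\<close> with upper index \<open>m\<close> and lower index \<open>2 * n - 1\<close>:\<close>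

definition linial_arrangement :: "nat \<Rightarrow> nat \<Rightarrow> complex vec set set" where
  "linial_arrangement n m =
     (let \<omega> = exp (2 * of_real pi * \<i> / of_nat m) :: complex in
       {{v \<in> carrier_vec (2 * n). x_coord v i - \<omega> ^ l * x_coord v j = y_coord n v i} | i j l.
          1 \<le> i \<and> i < j \<and> j \<le> n \<and> l < m} \<union>
       {{v \<in> carrier_vec (2 * n). x_coord v i = y_coord n v i} | i. 1 \<le> i \<and> i \<le> n})"


section \<open>The Dowling lattice\<close>

text \<open>
  A labeled partition is a pair \<open>(P, lab)\<close> of a partition \<open>P\<close> of \<open>{0..N}\<close> and a partial labeling
  \<open>lab\<close> defined exactly on the elements outside the zero block, i.e. the block containing \<open>0\<close>.
\<close>

type_synonym labeled_partition = "nat set set \<times> (nat \<rightharpoonup> nat)"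

definition labeled_partitions :: "nat \<Rightarrow> nat \<Rightarrow> labeled_partition set" where
  "labeled_partitions N m =
     {(P, lab). partition_on {0..N} P \<and> dom lab = \<Union>{B \<in> P. 0 \<notin> B} \<and> ran lab \<subseteq> {..<m} \<and>
        (\<forall>B\<in>P. 0 \<notin> B \<longrightarrow> lab (Min B) = Some 0)}"

inductive dowling_merge :: "nat \<Rightarrow> labeled_partition \<Rightarrow> labeled_partition \<Rightarrow> bool" for m where
  zero: "\<lbrakk>B\<^sub>0 \<in> P; 0 \<in> B\<^sub>0; B \<in> P; 0 \<notin> B\<rbrakk> \<Longrightarrow>
    dowling_merge m (P, lab) (insert (B\<^sub>0 \<union> B) (P - {B\<^sub>0, B}), lab |` (- B))"
| nonzero: "\<lbrakk>B \<in> P; 0 \<notin> B; C \<in> P; 0 \<notin> C; Min B < Min C; l < m\<rbrakk> \<Longrightarrow>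
    dowling_merge m (P, lab)
      (insert (B \<union> C) (P - {B, C}),
       \<lambda>x. if x \<in> C then map_option (\<lambda>a. (a + l) mod m) (lab x) else lab x)"

definition dowling_lattice :: "nat \<Rightarrow> nat \<Rightarrow> labeled_partition gorder" where
  "dowling_lattice N m =
     \<lparr>carrier = labeled_partitions N m, eq = (=), le = (dowling_merge m)\<^sup>*\<^sup>*\<rparr>"

text \<open>
  The order is the reflexive transitive closure of merging over all pairs of the type; the
  following two facts show that on the carrier it is a partial order that never leaves the carrier.
\<close>

lemma partition_on_merge:
  assumes "partition_on A P" "B \<in> P" "C \<in> P"
  shows "partition_on A (insert (B \<union> C) (P - {B, C}))"
  using assms unfolding partition_on_def disjoint_def by (auto; blast)

lemma dowling_merge_closed:
  assumes "dowling_merge m p q" "p \<in> labeled_partitions N m"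
  shows "q \<in> labeled_partitions N m"
  using assms
proof (induction rule: dowling_merge.induct)
  case (zero B\<^sub>0 P B lab)
  then have part: "partition_on {0..N} P" and dom: "dom lab = \<Union>{B \<in> P. 0 \<notin> B}"
    and ran: "ran lab \<subseteq> {..<m}" and min: "\<And>D. D \<in> P \<Longrightarrow> 0 \<notin> D \<Longrightarrow> lab (Min D) = Some 0"
    by (auto simp: labeled_partitions_def)
  have in_D: "Min D \<in> D" if "D \<in> P" for D
    using part that unfolding partition_on_def
    by (metis Min_in Union_upper finite_atLeastAtMost finite_subset)
  have disj: "D \<inter> E = {}" if "D \<in> P" "E \<in> P" "D \<noteq> E" for D E
    using part that unfolding partition_on_def disjoint_def by blast
  have dom': "dom (lab |` (- B)) = \<Union>{D \<in> insert (B\<^sub>0 \<union> B) (P - {B\<^sub>0, B}). 0 \<notin> D}"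
    using zero.hyps dom disj[OF _ zero.hyps(3)]
    by (simp add: dom_restrict) blast
  have ran': "ran (lab |` (- B)) \<subseteq> {..<m}"
    using ran by (auto simp: ran_def restrict_map_def split: if_splits)
  have min': "(lab |` (- B)) (Min D) = Some 0"
    if "D \<in> insert (B\<^sub>0 \<union> B) (P - {B\<^sub>0, B})" "0 \<notin> D" for D
    using that zero.hyps min[of D] in_D[of D] disj[of D B] by (auto simp: restrict_map_def)
  show ?case
    unfolding labeled_partitions_def
    using partition_on_merge[OF part zero.hyps(1,3)] dom' ran' min' by simp
next
  case (nonzero B P C l lab)
  define lab' where "lab' = (\<lambda>x. if x \<in> C then map_option (\<lambda>a. (a + l) mod m) (lab x) else lab x)"
  from nonzero have part: "partition_on {0..N} P" and dom: "dom lab = \<Union>{B \<in> P. 0 \<notin> B}"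
    and ran: "ran lab \<subseteq> {..<m}" and min: "\<And>D. D \<in> P \<Longrightarrow> 0 \<notin> D \<Longrightarrow> lab (Min D) = Some 0"
    by (auto simp: labeled_partitions_def)
  have ne: "finite D \<and> D \<noteq> {}" if "D \<in> P" for D
    using part that unfolding partition_on_def
    by (metis Union_upper finite_atLeastAtMost finite_subset)
  have disj: "D \<inter> E = {}" if "D \<in> P" "E \<in> P" "D \<noteq> E" for D E
    using part that unfolding partition_on_def disjoint_def by blast
  have "dom lab' = dom lab"
    unfolding lab'_def by (auto split: if_splits)
  moreover have "\<Union>{D \<in> insert (B \<union> C) (P - {B, C}). 0 \<notin> D} = \<Union>{D \<in> P. 0 \<notin> D}"
    (is "?L = ?R")
  proof
    show "?L \<subseteq> ?R" using nonzero.hyps(1-4) by auto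
    show "?R \<subseteq> ?L"
    proof
      fix x assume "x \<in> ?R"
      then obtain D where "D \<in> P" "0 \<notin> D" "x \<in> D" by auto
      then show "x \<in> ?L"
        using nonzero.hyps(2,4) by (cases "D = B \<or> D = C") auto
    qed
  qed
  ultimately have dom': "dom lab' = \<Union>{D \<in> insert (B \<union> C) (P - {B, C}). 0 \<notin> D}"
    using dom by simp
  have ran': "ran lab' \<subseteq> {..<m}"
  proof
    fix a assume "a \<in> ran lab'"
    then obtain x where x: "lab' x = Some a"
      by (auto simp: ran_def)
    show "a \<in> {..<m}"
    proof (cases "x \<in> C")
      case True
      with x obtain b where "a = (b + l) mod m"
        by (auto simp: lab'_def)
      with nonzero.hyps show ?thesis
        by simp
    next
      case False
      with x have "lab x = Some a"
        by (simp add: lab'_def)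
      with ran show ?thesis
        by (auto intro: ranI)
    qed
  qed
  have min_union: "Min (B \<union> C) = Min B"
    using ne nonzero.hyps by (simp add: Min_Un)
  have min_lab': "lab' (Min D) = Some 0" if "D \<in> P" "0 \<notin> D" "D \<noteq> C" for D
  proof -
    have "Min D \<in> D"
      using ne that by (simp add: Min_in)
    then have "Min D \<notin> C"
      using disj[of D C] nonzero.hyps that by auto
    then show ?thesis
      using min that by (simp add: lab'_def)
  qed
  have min': "lab' (Min D) = Some 0" if "D \<in> insert (B \<union> C) (P - {B, C})" "0 \<notin> D" for D
    using that min_lab' min_union nonzero.hyps by (metis Diff_iff insert_iff less_irrefl)
  show ?case
    unfolding labeled_partitions_def lab'_def[symmetric]
    using partition_on_merge[OF part nonzero.hyps(1,3)] dom' ran' min' by simp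
qed

lemma dowling_merge_card:
  assumes "dowling_merge m p q" "p \<in> labeled_partitions N m"
  shows "card (fst q) < card (fst p)"
proof -
  have *: "card (insert (B \<union> C) (P - {B, C})) < card P"
    if "finite P" "B \<in> P" "C \<in> P" "B \<noteq> C" for B C :: "nat set" and P
  proof -
    have "card (P - {B, C}) = card P - 2" and "card P \<ge> 2"
      using that card_Diff_subset[of "{B, C}" P] card_mono[of P "{B, C}"] by auto
    then show ?thesis
      using card_insert_le_m1[of "card P - 1" "P - {B, C}" "B \<union> C"] by linarith
  qed
  have "finite (fst p)"
    using assms(2) by (auto simp: labeled_partitions_def intro: finite_elements)
  with assms(1) show ?thesis
    by cases (auto intro!: *)
qed

lemma partial_order_dowling_lattice: "partial_order (dowling_lattice N m)"
proof -
  have step: "q \<in> labeled_partitions N m \<and> (p = q \<or> card (fst q) < card (fst p))"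
    if "(dowling_merge m)\<^sup>*\<^sup>* p q" "p \<in> labeled_partitions N m" for p q
    using that
    by (induction rule: rtranclp_induct)
      (auto dest: dowling_merge_closed dowling_merge_card)
  show ?thesis
    by unfold_locales (auto simp: dowling_lattice_def dest!: step)
qed

text \<open>The induced subposet written \<open>\<L>\<close> with upper index \<open>m\<close> and lower index \<open>2 * n - 1\<close>:\<close>

definition linial_partition :: "labeled_partition \<Rightarrow> bool" where
  "linial_partition p \<longleftrightarrow>
     (\<forall>B \<in> fst p.
        if 0 \<in> B then B \<noteq> {0} \<longrightarrow> odd (Min (B - {0}))
        else \<not> is_singleton B \<longrightarrow> odd (Min B) \<and> even (Max B))"

definition linial_subposet :: "nat \<Rightarrow> nat \<Rightarrow> labeled_partition gorder" where
  "linial_subposet n m =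
     (dowling_lattice (2 * n - 1) m)
       \<lparr>carrier := {p \<in> carrier (dowling_lattice (2 * n - 1) m). linial_partition p}\<rparr>"

end

theory Submission
  imports Defs
begin

text \<open>
  The linear change of coordinates \<open>z\<close> of index \<open>2 * i - 1\<close> equal to \<open>x\<^sub>i - y\<^sub>i\<close> and of index
  \<open>2 * j - 2\<close> equal to \<open>x\<^sub>j\<close> (for \<open>j \<ge> 2\<close>) turns the arrangement into the part of the Dowling
  arrangement given by \<open>z\<^sub>i = 0\<close> for odd \<open>i\<close> and \<open>z\<^sub>i = \<omega>\<^sup>l z\<^sub>j\<close> for odd \<open>i\<close> and even \<open>j > i\<close>. A labeled
  partition determines the subspace on which the zero block vanishes and the vectors
  \<open>\<omega>\<^sup>l z\<close>, with \<open>l\<close> the label, are constant on the other blocks. Testing inclusions on vectors supported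
  on one block shows that merging is exactly reverse inclusion of these subspaces. Intersections
  of hyperplanes are the subspaces whose nonsingleton blocks are connected by the available
  equations, which is a condition on the parity of their minima and maxima.
\<close>

text \<open>The map with an explicit formula goes from labeled partitions to subspaces, against the
  direction of \<open>poset_isomorphic\<close>; an order-reflecting bijection can be
  inverted.\<close>

lemma poset_isomorphicI:
  assumes "partial_order A" "partial_order B" "bij_betw g (carrier B) (carrier A)"
    and "\<And>p q. p \<in> carrier B \<Longrightarrow> q \<in> carrier B \<Longrightarrow> g p \<sqsubseteq>\<^bsub>A\<^esub> g q \<longleftrightarrow> p \<sqsubseteq>\<^bsub>B\<^esub> q"
  shows "poset_isomorphic A B"
proof -
  let ?f = "inv_into (carrier B) g"
  have f: "bij_betw ?f (carrier A) (carrier B)"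
    using assms(3) by (rule bij_betw_inv_into)
  have "?f x \<in> carrier B" "g (?f x) = x" if "x \<in> carrier A" for x
    using that assms(3) f by (auto simp: bij_betw_def f_inv_into_f)
  then have "order_emb A B ?f"
    unfolding order_emb_def using assms(1,2)
    by (simp add: partial_order.axioms(1) flip: assms(4))
  with assms(1,2) f show ?thesis
    unfolding poset_isomorphic_def by blast
qed

section \<open>Subspaces of labeled partitions\<close>

definition unity_root :: "nat \<Rightarrow> complex" where
  "unity_root m = cis (2 * pi / real m)"

lemma unity_root_power: "unity_root m ^ l = cis (2 * pi * real l / real m)"
  by (simp add: unity_root_def DeMoivre mult_ac)

lemma unity_root_power_self: "m > 0 \<Longrightarrow> (unity_root m ^ l) ^ m = 1"
  using cis_multiple_2pi[of "real l"]
  by (simp add: unity_root_def DeMoivre mult_ac flip: power_mult)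

lemma unity_root_power_mod:
  assumes "m > 0"
  shows "unity_root m ^ (k mod m) = unity_root m ^ k"
proof -
  have "unity_root m ^ k = unity_root m ^ (m * (k div m) + k mod m)"
    by simp
  also have "\<dots> = (unity_root m ^ m) ^ (k div m) * unity_root m ^ (k mod m)"
    by (simp only: power_add power_mult)
  finally show ?thesis
    using unity_root_power_self[OF assms, of 1] by simp
qed

lemma unity_root_power_inj:
  assumes "unity_root m ^ a = unity_root m ^ b" "a < m" "b < m"
  shows "a = b"
  using bij_betw_roots_unity[of m] assms
  by (auto simp: unity_root_power bij_betw_def dest: inj_onD)

lemma unity_root_power_surj:
  assumes "z ^ m = 1" "m > 0"
  shows "\<exists>l<m. z = unity_root m ^ l"
proof -
  have "z \<in> (\<lambda>k. cis (2 * pi * real k / real m)) ` {..<m}"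
    using bij_betw_roots_unity[of m] assms by (simp add: bij_betw_def)
  then show ?thesis
    by (auto simp: unity_root_power)
qed

text \<open>Labels are written multiplicatively: addition modulo \<open>m\<close> becomes
  multiplication of \<open>m\<close>-th roots of unity. The default \<open>1\<close> is meant for
  the zero block, whose elements carry no label.\<close>

definition gain :: "nat \<Rightarrow> (nat \<rightharpoonup> nat) \<Rightarrow> nat \<Rightarrow> complex" where
  "gain m lab i = (case lab i of None \<Rightarrow> 1 | Some a \<Rightarrow> unity_root m ^ a)"

lemma gain_power: "m > 0 \<Longrightarrow> gain m lab i ^ m = 1"
  by (simp add: gain_def unity_root_power_self split: option.split)

lemma gain_nonzero: "gain m lab i \<noteq> 0"
  by (simp add: gain_def unity_root_def split: option.split)

text \<open>The label shift of a nonzero merge scales all gains on the moved block by one common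
  factor. The assumption on \<open>C\<close> matters: an unlabeled element would keep gain
  \<open>1\<close>.\<close>

lemma gain_shift:
  assumes "m > 0" "x \<in> C \<Longrightarrow> lab x \<noteq> None"
  shows "gain m (\<lambda>x. if x \<in> C then map_option (\<lambda>a. (a + l) mod m) (lab x) else lab x) x =
    (if x \<in> C then unity_root m ^ l * gain m lab x else gain m lab x)"
  using assms by (auto simp: gain_def unity_root_power_mod power_add)

text \<open>
  The requirement \<open>w 0 = 0\<close> makes the condition for the zero block, on which the gain is \<open>1\<close>,
  say that \<open>w\<close> vanishes there.
\<close>

definition flat :: "nat \<Rightarrow> labeled_partition \<Rightarrow> (nat \<Rightarrow> complex) set" where
  "flat m p = {w. w 0 = 0 \<and>
     (\<forall>B\<in>fst p. \<forall>i\<in>B. \<forall>j\<in>B. gain m (snd p) i * w i = gain m (snd p) j * w j)}"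

lemma flatI:
  assumes "w 0 = 0"
    and "\<And>B i j. B \<in> fst p \<Longrightarrow> i \<in> B \<Longrightarrow> j \<in> B \<Longrightarrow>
      gain m (snd p) i * w i = gain m (snd p) j * w j"
  shows "w \<in> flat m p"
  using assms unfolding flat_def by blast

lemma flatD:
  "w \<in> flat m p \<Longrightarrow> B \<in> fst p \<Longrightarrow> i \<in> B \<Longrightarrow> j \<in> B \<Longrightarrow>
    gain m (snd p) i * w i = gain m (snd p) j * w j"
  unfolding flat_def by blast

lemma flat_0: "w \<in> flat m p \<Longrightarrow> w 0 = 0"
  unfolding flat_def by blast

section \<open>Blocks, labels and gains of one labeled partition\<close>

context
  fixes p :: labeled_partition and N m :: nat
  assumes p: "p \<in> labeled_partitions N m"
begin

lemma lp_partition: "partition_on {0..N} (fst p)"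
  using p by (auto simp: labeled_partitions_def)

lemma lp_block: "B \<in> fst p \<Longrightarrow> finite B \<and> B \<noteq> {} \<and> B \<subseteq> {0..N}"
  using lp_partition unfolding partition_on_def
  by (metis Union_upper finite_atLeastAtMost finite_subset)

lemma lp_bound: "B \<in> fst p \<Longrightarrow> i \<in> B \<Longrightarrow> i \<le> N"
  using lp_block[of B] by auto

lemma lp_disjoint: "B \<in> fst p \<Longrightarrow> C \<in> fst p \<Longrightarrow> i \<in> B \<Longrightarrow> i \<in> C \<Longrightarrow> B = C"
  using lp_partition unfolding partition_on_def disjoint_def by blast

lemma lp_cover:
  assumes "i \<le> N"
  shows "\<exists>B\<in>fst p. i \<in> B"
proof -
  have "i \<in> \<Union>(fst p)"
    using lp_partition assms by (simp add: partition_on_def)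
  then show ?thesis by blast
qed

lemma lp_dom: "dom (snd p) = \<Union>{B \<in> fst p. 0 \<notin> B}"
  using p by (cases p) (simp add: labeled_partitions_def)

lemma lp_label_None:
  assumes "B \<in> fst p" "0 \<in> B" "i \<in> B"
  shows "snd p i = None"
proof -
  have "i \<notin> dom (snd p)"
    unfolding lp_dom using assms lp_disjoint by blast
  then show ?thesis by auto
qed

lemma lp_label_Some:
  assumes "B \<in> fst p" "0 \<notin> B" "i \<in> B"
  shows "\<exists>a<m. snd p i = Some a"
proof -
  have "ran (snd p) \<subseteq> {..<m}"
    using p by (auto simp: labeled_partitions_def)
  moreover have "i \<in> dom (snd p)"
    unfolding lp_dom using assms by blast
  ultimately show ?thesis
    by (auto simp: ran_def)
qed

lemma lp_gain_zero: "B \<in> fst p \<Longrightarrow> 0 \<in> B \<Longrightarrow> i \<in> B \<Longrightarrow> gain m (snd p) i = 1"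
  using lp_label_None[of B i] by (simp add: gain_def)

lemma lp_gain_Min: "B \<in> fst p \<Longrightarrow> 0 \<notin> B \<Longrightarrow> gain m (snd p) (Min B) = 1"
  using p by (cases p) (simp add: labeled_partitions_def gain_def)

lemma flat_zero_block: "w \<in> flat m p \<Longrightarrow> B \<in> fst p \<Longrightarrow> 0 \<in> B \<Longrightarrow> i \<in> B \<Longrightarrow> w i = 0"
  using flatD[of w m p B i 0] flat_0[of w m p] lp_gain_zero[of B i] by simp

text \<open>The product with the gain is \<open>1\<close> on \<open>D\<close> and \<open>0\<close>
  on all other blocks. These are the test vectors for inclusions of flats;
  \<open>0 \<notin> D\<close> secures the value \<open>0\<close> at index \<open>0\<close>.\<close>

lemma flat_block_vector:
  assumes "D \<in> fst p" "0 \<notin> D"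
  shows "(\<lambda>k. if k \<in> D then inverse (gain m (snd p) k) else 0) \<in> flat m p"
proof -
  let ?g = "gain m (snd p)" and ?w = "\<lambda>k. if k \<in> D then inverse (gain m (snd p) k) else 0"
  have "?g i * ?w i = ?g j * ?w j" if B: "B \<in> fst p" "i \<in> B" "j \<in> B" for B i j
  proof (cases "B = D")
    case True
    with B show ?thesis by (auto simp: gain_nonzero)
  next
    case False
    then have "i \<notin> D" "j \<notin> D"
      using B assms(1) lp_disjoint[of B D i] lp_disjoint[of B D j] by auto
    then show ?thesis by simp
  qed
  moreover have "?w 0 = 0"
    using assms(2) by simp
  ultimately show ?thesis
    by (rule flatI[rotated])
qed

end

text \<open>After a zero merge, a vector of the flat vanishes on \<open>B0 \<union> B\<close>, which
  implies the old equations there. After a nonzero merge, the gains on \<open>C\<close> differ from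
  the old ones by a common factor, which cancels from the equations inside \<open>C\<close>.\<close>

lemma flat_merge:
  assumes "dowling_merge m p q" "p \<in> labeled_partitions N m"
  shows "flat m q \<subseteq> flat m p"
  using assms
proof (induction rule: dowling_merge.induct)
  case (zero B0 P B lab)
  note lp = zero.prems
  show ?case
  proof
    fix w assume w: "w \<in> flat m (insert (B0 \<union> B) (P - {B0, B}), lab |` (- B))"
    have gain_eq: "gain m (lab |` (- B)) i = gain m lab i" if "i \<notin> B" for i
      using that by (simp add: gain_def)
    have van: "w i = 0" if i: "i \<in> B0 \<union> B" for i
    proof -
      have "lab k = None" if "k \<in> B0" for k
        using lp_label_None[OF lp, of B0] zero.hyps that by simp
      then have "gain m (lab |` (- B)) k = 1" if "k \<in> B0 \<union> B" for k
        using that by (auto simp: gain_def restrict_map_def)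
      then show ?thesis
        using flatD[OF w, of "B0 \<union> B" i 0] flat_0[OF w] i zero.hyps by simp
    qed
    have "gain m (snd (P, lab)) i * w i = gain m (snd (P, lab)) j * w j"
      if D: "D \<in> fst (P, lab)" "i \<in> D" "j \<in> D" for D i j
    proof (cases "D = B0 \<or> D = B")
      case True
      then have "i \<in> B0 \<union> B" "j \<in> B0 \<union> B" using D by auto
      then show ?thesis by (simp add: van)
    next
      case False
      then have "i \<notin> B" "j \<notin> B"
        using lp_disjoint[OF lp, of D B] D zero.hyps by auto
      then show ?thesis
        using flatD[OF w, of D i j] D False gain_eq by simp
    qed
    with flat_0[OF w] show "w \<in> flat m (P, lab)"
      by (rule flatI)
  qed
next
  case (nonzero B P C l lab)
  note lp = nonzero.prems
  define lab' where "lab' = (\<lambda>x. if x \<in> C then map_option (\<lambda>a. (a + l) mod m) (lab x) else lab x)"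
  have m: "m > 0" using nonzero.hyps by simp
  have lab_C: "lab i \<noteq> None" if "i \<in> C" for i
    using lp_label_Some[OF lp, of C i] nonzero.hyps that by auto
  have gain_eq: "gain m lab' i = gain m lab i" if "i \<notin> C" for i
    unfolding lab'_def using gain_shift[OF m, of i C lab l] that by simp
  have gain_C: "gain m lab' i = unity_root m ^ l * gain m lab i" if "i \<in> C" for i
    unfolding lab'_def using gain_shift[OF m, of i C lab l] lab_C that by simp
  have "flat m (insert (B \<union> C) (P - {B, C}), lab') \<subseteq> flat m (P, lab)"
  proof
    fix w assume w: "w \<in> flat m (insert (B \<union> C) (P - {B, C}), lab')"
    have "gain m (snd (P, lab)) i * w i = gain m (snd (P, lab)) j * w j"
      if D: "D \<in> fst (P, lab)" "i \<in> D" "j \<in> D" for D i j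
    proof -
      have eq: "gain m lab' i * w i = gain m lab' j * w j"
        using flatD[OF w, of "B \<union> C" i j] flatD[OF w, of D i j] D by auto
      show ?thesis
      proof (cases "D = C")
        case True
        then show ?thesis
          using eq D gain_C by (simp add: unity_root_def)
      next
        case False
        then have "i \<notin> C" "j \<notin> C"
          using lp_disjoint[OF lp, of D C] D nonzero.hyps by auto
        then show ?thesis
          using eq gain_eq by simp
      qed
    qed
    with flat_0[OF w] show "w \<in> flat m (P, lab)"
      by (rule flatI)
  qed
  then show ?case
    by (simp add: lab'_def)
qed

section \<open>Consequences of an inclusion of flats\<close>

context
  fixes p q :: labeled_partition and N m :: nat
  assumes m: "m > 0" and p: "p \<in> labeled_partitions N m" and q: "q \<in> labeled_partitions N m"
    and sub: "flat m q \<subseteq> flat m p"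
begin

text \<open>The test vector of \<open>D\<close> lies in the flat of \<open>p\<close> and is nonzero
  at \<open>i\<close>, so the equation for \<open>i\<close> and \<open>j\<close> in \<open>B\<close>
  forces it to be nonzero at \<open>j\<close>; its values then compare the gains.\<close>

lemma flat_subset_nonzero:
  assumes "B \<in> fst p" "D \<in> fst q" "0 \<notin> D" "i \<in> B" "i \<in> D" "j \<in> B"
  shows "j \<in> D" and "gain m (snd p) i * gain m (snd q) j = gain m (snd p) j * gain m (snd q) i"
proof -
  let ?w = "\<lambda>k. if k \<in> D then inverse (gain m (snd q) k) else 0"
  have "?w \<in> flat m p"
    using flat_block_vector[OF q] assms sub by blast
  from flatD[OF this assms(1,4,6)]
  have eq: "gain m (snd p) i * ?w i = gain m (snd p) j * ?w j" .
  then show "j \<in> D"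
    using assms by (auto simp: gain_nonzero split: if_splits)
  with eq show "gain m (snd p) i * gain m (snd q) j = gain m (snd p) j * gain m (snd q) i"
    using assms by (simp add: gain_nonzero field_simps)
qed

lemma flat_subset_block:
  assumes "B \<in> fst p" "D \<in> fst q" "i \<in> B" "i \<in> D"
  shows "B \<subseteq> D"
proof
  fix j assume j: "j \<in> B"
  show "j \<in> D"
  proof (cases "0 \<in> D")
    case True
    \<comment> \<open>A zero block has no test vector. That of the block \<open>E\<close> of an
      escaping \<open>j\<close> is used instead: it pulls \<open>i\<close> into \<open>E\<close>,
      although \<open>i\<close> lies in \<open>D\<close>.\<close>
    show ?thesis
    proof (rule ccontr)
      assume nj: "j \<notin> D"
      obtain E where E: "E \<in> fst q" "j \<in> E"
        using lp_cover[OF q lp_bound[OF p assms(1) j]] by blast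
      then have "0 \<notin> E"
        using lp_disjoint[OF q E(1) assms(2), of 0] True nj by auto
      then have "i \<in> E"
        using flat_subset_nonzero(1)[of B E j i] assms E j by simp
      then show False
        using lp_disjoint[OF q E(1) assms(2), of i] assms E nj by simp
    qed
  next
    case False
    then show ?thesis
      using flat_subset_nonzero(1)[of B D i j] assms j by simp
  qed
qed

text \<open>With equal blocks, test vectors give equal ratios of gains inside each nonzero block.
  The gain at the minimum is \<open>1\<close> on both sides, so the gains agree, and with them the
  labels, which are below \<open>m\<close>.\<close>

lemma flat_subset_eq:
  assumes "fst p = fst q"
  shows "p = q"
proof -
  have "snd p i = snd q i" for i
  proof (cases "i \<le> N")
    case False
    have "dom (snd r) \<subseteq> {0..N}" if r: "r \<in> labeled_partitions N m" for r
      unfolding lp_dom[OF r] using lp_block[OF r] by blast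
    from this[OF p] this[OF q] False have "i \<notin> dom (snd p)" "i \<notin> dom (snd q)"
      by auto
    then show ?thesis by (simp add: domIff)
  next
    case True
    then obtain B where B: "B \<in> fst p" "B \<in> fst q" "i \<in> B"
      using lp_cover[OF p] assms by auto
    show ?thesis
    proof (cases "0 \<in> B")
      case True
      then show ?thesis
        using B lp_label_None[OF p] lp_label_None[OF q] by simp
    next
      case False
      obtain a b where ab: "a < m" "snd p i = Some a" "b < m" "snd q i = Some b"
        using lp_label_Some[OF p B(1) False B(3)] lp_label_Some[OF q B(2) False B(3)] by blast
      have MB: "Min B \<in> B"
        using lp_block[OF p B(1)] by simp
      have "gain m (snd p) i = gain m (snd q) i"
        using flat_subset_nonzero(2)[OF B(1,2) False B(3) B(3) MB]
          lp_gain_Min[OF p B(1) False] lp_gain_Min[OF q B(2) False] by simp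
      then show ?thesis
        using ab unity_root_power_inj[of m a b] by (simp add: gain_def)
    qed
  qed
  with assms show ?thesis
    by (simp add: prod_eq_iff fun_eq_iff)
qed

text \<open>By \<open>flat_subset_block\<close> the blocks of \<open>p\<close> refine those of
  \<open>q\<close>, so if they differ, two of them lie inside one block of \<open>q\<close>. Merging
  two such blocks, with the shift that the gains of \<open>q\<close> dictate, keeps the flat of
  \<open>q\<close> inside.\<close>

lemma flat_subset_step:
  assumes "fst p \<noteq> fst q"
  shows "\<exists>p'. dowling_merge m p p' \<and> flat m q \<subseteq> flat m p'"
proof -
  obtain D B C where D: "D \<in> fst q" and B: "B \<in> fst p" "B \<subseteq> D"
    and C: "C \<in> fst p" "C \<subseteq> D" and BC: "B \<noteq> C"
  proof -
    have "\<exists>D\<in>fst q. D \<notin> fst p"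
    proof (rule ccontr)
      assume "\<not> ?thesis"
      then have s: "fst q \<subseteq> fst p" by auto
      have "B \<in> fst q" if B: "B \<in> fst p" for B
      proof -
        obtain i where i: "i \<in> B" "i \<le> N"
          using lp_block[OF p B] by force
        then obtain D where "D \<in> fst q" "i \<in> D"
          using lp_cover[OF q] by auto
        then show ?thesis
          using lp_disjoint[OF p B, of D i] s i by auto
      qed
      with s assms show False by auto
    qed
    then obtain D where D: "D \<in> fst q" "D \<notin> fst p" by auto
    obtain i where i: "i \<in> D" "i \<le> N"
      using lp_block[OF q D(1)] by force
    then obtain B where B: "B \<in> fst p" "i \<in> B"
      using lp_cover[OF p] by auto
    then have "B \<subseteq> D" "B \<noteq> D"
      using flat_subset_block D i by blast+
    moreover from this obtain j where j: "j \<in> D" "j \<notin> B"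
      by blast
    moreover obtain C where C: "C \<in> fst p" "j \<in> C"
      using lp_cover[OF p lp_bound[OF q D(1) j(1)]] by blast
    moreover have "C \<subseteq> D"
      using flat_subset_block[OF C(1) D(1) C(2) j(1)] .
    ultimately show ?thesis
      using that D B by blast
  qed
  obtain P lab where P: "p = (P, lab)" by force
  show ?thesis
  proof (cases "0 \<in> D")
    case True
    \<comment> \<open>The zero block of \<open>p\<close> lies in \<open>D\<close> as well, and one
      of \<open>B\<close>, \<open>C\<close> differs from it; that one is absorbed. The flat of
      \<open>q\<close> vanishes on all of \<open>D\<close>.\<close>
    obtain B0 where B0: "B0 \<in> fst p" "0 \<in> B0"
      using lp_cover[OF p, of 0] by auto
    then have B0D: "B0 \<subseteq> D"
      using flat_subset_block D True by blast
    obtain E where E: "E \<in> fst p" "E \<subseteq> D" "E \<noteq> B0"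
      using B C BC by metis
    then have E0: "0 \<notin> E"
      using lp_disjoint[OF p, of E B0] B0 by blast
    let ?p' = "(insert (B0 \<union> E) (P - {B0, E}), lab |` (- E))"
    have "dowling_merge m p ?p'"
      using B0 E E0 by (simp add: P dowling_merge.zero)
    moreover have "w \<in> flat m ?p'" if w: "w \<in> flat m q" for w
    proof -
      have wp: "w \<in> flat m (P, lab)" using w sub P by blast
      have van: "w i = 0" if "i \<in> B0 \<union> E" for i
        using flat_zero_block[OF q w D True] B0D E that by blast
      have "gain m (lab |` (- E)) i * w i = gain m (lab |` (- E)) j * w j"
        if F: "F \<in> P" "F \<noteq> E" "i \<in> F" "j \<in> F" for F i j
      proof -
        have "i \<notin> E" "j \<notin> E"
          using lp_disjoint[OF p, of F E] F E P by auto
        then show ?thesis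
          using flatD[OF wp, of F i j] F by (simp add: gain_def)
      qed
      then have "gain m (snd ?p') i * w i = gain m (snd ?p') j * w j"
        if "F \<in> fst ?p'" "i \<in> F" "j \<in> F" for F i j
        using that van[of i] van[of j] E by (cases "F = B0 \<union> E") auto
      with flat_0[OF w] show ?thesis
        by (rule flatI)
    qed
    ultimately show ?thesis by blast
  next
    case False
    have "\<exists>B C. B \<in> fst p \<and> B \<subseteq> D \<and> C \<in> fst p \<and> C \<subseteq> D \<and> Min B < Min C"
    proof -
      have "Min B \<in> B" "Min C \<in> C"
        using lp_block[OF p] B C by auto
      then have "Min B \<noteq> Min C"
        using lp_disjoint[OF p B(1) C(1), of "Min B"] BC by auto
      with B C show ?thesis
        by (metis linorder_neqE_nat)
    qed
    then obtain B C where B: "B \<in> fst p" "B \<subseteq> D" and C: "C \<in> fst p" "C \<subseteq> D"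
      and less: "Min B < Min C"
      by blast
    have mins: "Min B \<in> B" "Min C \<in> C"
      using lp_block[OF p] B C by auto
    have BC: "B \<noteq> C" using less by auto
    let ?g = "gain m (snd p)" and ?h = "gain m (snd q)"
    \<comment> \<open>On the flat of \<open>q\<close>, \<open>w (Min B) = r * w (Min C)\<close>. As
      the gains of \<open>p\<close> at both minima are \<open>1\<close>, shifting \<open>C\<close>
      by the exponent of \<open>r\<close> gives the merged block the common value
      \<open>w (Min B)\<close>.\<close>
    define r where "r = ?h (Min C) / ?h (Min B)"
    have "r ^ m = 1"
      using m by (simp add: r_def power_divide gain_power)
    then obtain l where l: "l < m" "r = unity_root m ^ l"
      using unity_root_power_surj m by blast
    define lab' where "lab' = (\<lambda>x. if x \<in> C then map_option (\<lambda>a. (a + l) mod m) (lab x) else lab x)"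
    let ?p' = "(insert (B \<union> C) (P - {B, C}), lab')"
    have merge: "dowling_merge m p ?p'"
      unfolding P lab'_def
      by (rule dowling_merge.nonzero) (use B C False less l P in auto)
    have lab_C: "lab i \<noteq> None" if "i \<in> C" for i
      using lp_label_Some[OF p, of C i] C False that P by auto
    have gain_eq: "gain m lab' i = ?g i" if "i \<notin> C" for i
      unfolding lab'_def P using gain_shift[OF m, of i C lab l] that by simp
    have gain_C: "gain m lab' i = r * ?g i" if "i \<in> C" for i
      unfolding lab'_def P using gain_shift[OF m, of i C lab l] lab_C that l by simp
    have "w \<in> flat m ?p'" if w: "w \<in> flat m q" for w
    proof -
      have wp: "w \<in> flat m (P, lab)" using w sub P by blast
      have "gain m lab' i * w i = gain m lab' j * w j"
        if F: "F \<in> P" "F \<noteq> C" "i \<in> F" "j \<in> F" for F i j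
      proof -
        have "i \<notin> C" "j \<notin> C"
          using lp_disjoint[OF p, of F C] F C P by auto
        then show ?thesis
          using flatD[OF wp, of F i j] F P gain_eq by simp
      qed
      moreover have "gain m lab' i * w i = w (Min B)" if i: "i \<in> B \<union> C" for i
      proof (cases "i \<in> C")
        case True
        have eqC: "?g i * w i = w (Min C)"
          using flatD[OF wp, of C i "Min C"] C mins True P lp_gain_Min[OF p C(1)] False by auto
        have eqD: "?h (Min C) * w (Min C) = ?h (Min B) * w (Min B)"
          using flatD[OF w D, of "Min C" "Min B"] B C mins by blast
        have "gain m lab' i * w i = r * (?g i * w i)"
          using True gain_C by simp
        also have "\<dots> = w (Min B)"
          unfolding eqC using eqD by (simp add: r_def gain_nonzero field_simps)
        finally show ?thesis .
      next
        case nC: False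
        with i have "i \<in> B" by simp
        then have "?g i * w i = w (Min B)"
          using flatD[OF wp, of B i "Min B"] B mins P lp_gain_Min[OF p B(1)] False by auto
        with nC gain_eq show ?thesis by simp
      qed
      ultimately have "gain m (snd ?p') i * w i = gain m (snd ?p') j * w j"
        if "F \<in> fst ?p'" "i \<in> F" "j \<in> F" for F i j
        using that by (cases "F = B \<union> C") auto
      with flat_0[OF w] show ?thesis
        by (rule flatI)
    qed
    with merge show ?thesis by blast
  qed
qed

end

text \<open>Each merge shrinks the flat. Conversely, while the blocks differ,
  \<open>flat_subset_step\<close> merges towards \<open>q\<close>; this lowers the number of blocks,
  so it stops, and equal blocks mean \<open>p = q\<close> by \<open>flat_subset_eq\<close>.\<close>

lemma dowling_le_iff_flat:
  assumes "m > 0" "p \<in> labeled_partitions N m" "q \<in> labeled_partitions N m"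
  shows "(dowling_merge m)\<^sup>*\<^sup>* p q \<longleftrightarrow> flat m q \<subseteq> flat m p"
proof
  assume "(dowling_merge m)\<^sup>*\<^sup>* p q"
  then have "q \<in> labeled_partitions N m \<and> flat m q \<subseteq> flat m p"
    using assms(2)
    by (induction rule: rtranclp_induct) (use flat_merge dowling_merge_closed in blast)+
  then show "flat m q \<subseteq> flat m p" by simp
next
  assume "flat m q \<subseteq> flat m p"
  with assms(2) show "(dowling_merge m)\<^sup>*\<^sup>* p q"
  proof (induction "card (fst p)" arbitrary: p rule: less_induct)
    case less
    show ?case
    proof (cases "fst p = fst q")
      case True
      then have "p = q"
        using flat_subset_eq[OF assms(1) less.prems(1) assms(3) less.prems(2)] by simp
      then show ?thesis by simp
    next
      case False
      then obtain p' where p': "dowling_merge m p p'" "flat m q \<subseteq> flat m p'"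
        using flat_subset_step[OF assms(1) less.prems(1) assms(3) less.prems(2)] by auto
      then have "(dowling_merge m)\<^sup>*\<^sup>* p' q"
        using less dowling_merge_card dowling_merge_closed by blast
      with p' show ?thesis
        by (simp add: converse_rtranclp_into_rtranclp)
    qed
  qed
qed


section \<open>Subspaces cut out by edges\<close>

text \<open>Vectors are functions on all natural numbers, but blocks constrain only the indices up
  to \<open>N\<close>. The coordinates of a point of the ambient space are controlled only up to
  there.\<close>

lemma flat_cong:
  assumes "p \<in> labeled_partitions N m" "\<And>k. k \<le> N \<Longrightarrow> w k = w' k" "w \<in> flat m p"
  shows "w' \<in> flat m p"
proof (rule flatI)
  show "w' 0 = 0"
    using assms(2)[of 0] flat_0[OF assms(3)] by simp
next
  fix B i j assume B: "B \<in> fst p" "i \<in> B" "j \<in> B"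
  then have "i \<le> N" "j \<le> N"
    using lp_bound[OF assms(1)] by blast+
  then show "gain m (snd p) i * w' i = gain m (snd p) j * w' j"
    using flatD[OF assms(3) B] assms(2)[of i] assms(2)[of j] by simp
qed

text \<open>An edge \<open>(i, j, l)\<close> with \<open>j = 0\<close> stands for the equation \<open>w i = 0\<close>.\<close>

definition linial_edges :: "nat \<Rightarrow> nat \<Rightarrow> (nat \<times> nat \<times> nat) set" where
  "linial_edges N m = {(i, j, l). odd i \<and> i \<le> N \<and> even j \<and> j \<le> N \<and> (j = 0 \<or> i < j) \<and> l < m}"

definition edge_flat :: "nat \<Rightarrow> (nat \<times> nat \<times> nat) set \<Rightarrow> (nat \<Rightarrow> complex) set" where
  "edge_flat m E = {w. w 0 = 0 \<and> (\<forall>i j l. (i, j, l) \<in> E \<longrightarrow> w i = unity_root m ^ l * w j)}"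

lemma edge_flatD:
  assumes "w \<in> edge_flat m E"
  shows "w 0 = 0" "(i, j, l) \<in> E \<Longrightarrow> w i = unity_root m ^ l * w j"
  using assms unfolding edge_flat_def by blast+

lemma edge_flatI:
  assumes "w 0 = 0" "\<And>i j l. (i, j, l) \<in> E \<Longrightarrow> w i = unity_root m ^ l * w j"
  shows "w \<in> edge_flat m E"
  using assms unfolding edge_flat_def by blast

text \<open>
  In a nonzero block with odd minimum and even maximum, every odd element lies below the maximum
  and every even element above the minimum, so the edges inside the block connect it.
\<close>

lemma flat_eq_edge_flat:
  assumes m: "m > 0" and p: "p \<in> labeled_partitions N m" and lin: "linial_partition p"
  shows "\<exists>E\<subseteq>linial_edges N m. flat m p = edge_flat m E"
proof -
  \<comment> \<open>Taking every edge equation that holds on the flat makes one inclusion automatic;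
    the other needs only that enough edges are present.\<close>
  define E where
    "E = {(i, j, l) \<in> linial_edges N m. \<forall>w\<in>flat m p. w i = unity_root m ^ l * w j}"
  have sub: "E \<subseteq> linial_edges N m"
    by (auto simp: E_def)
  have "flat m p \<subseteq> edge_flat m E"
  proof
    fix w assume w: "w \<in> flat m p"
    show "w \<in> edge_flat m E"
      by (rule edge_flatI) (use w flat_0[OF w] in \<open>auto simp: E_def\<close>)
  qed
  moreover have "edge_flat m E \<subseteq> flat m p"
  proof
    fix w assume w: "w \<in> edge_flat m E"
    show "w \<in> flat m p"
    proof (rule flatI)
      show "w 0 = 0"
        using edge_flatD(1)[OF w] .
    next
      fix B i j assume B: "B \<in> fst p" and ij: "i \<in> B" "j \<in> B"
      have fin: "finite B"
        using lp_block[OF p B] by simp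
      show "gain m (snd p) i * w i = gain m (snd p) j * w j"
      proof (cases "0 \<in> B")
        case True
        have odd_zero: "w k = 0" if k: "k \<in> B" "odd k" for k
        proof -
          have "v k = unity_root m ^ 0 * v 0" if "v \<in> flat m p" for v
            using flat_zero_block[OF p that B True k(1)] flat_0[OF that] by simp
          then have "(k, 0, 0) \<in> E"
            using k m lp_bound[OF p B k(1)] by (simp add: E_def linial_edges_def)
          then show ?thesis
            using edge_flatD[OF w] by fastforce
        qed
        have "w k = 0" if k: "k \<in> B" for k
        proof (cases "odd k \<or> k = 0")
          case True
          then show ?thesis
            using odd_zero k edge_flatD(1)[OF w] by auto
        next
          case False
          \<comment> \<open>An even positive \<open>k\<close> has no edge to \<open>0\<close>; it is
            tied to the least positive element \<open>u\<close>, which is odd and so has one. Any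
            label serves here, hence \<open>0\<close>.\<close>
          define u where "u = Min (B - {0})"
          have ne: "k \<in> B - {0}" using k False by simp
          then have u: "u \<in> B - {0}" "u \<le> k"
            unfolding u_def using fin Min_in[of "B - {0}"] Min_le[of "B - {0}" k] by blast+
          have "odd u"
            using lin B \<open>0 \<in> B\<close> ne unfolding linial_partition_def u_def by force
          with u False have "u < k"
            by (metis le_neq_implies_less)
          have "v u = unity_root m ^ 0 * v k" if "v \<in> flat m p" for v
            using flat_zero_block[OF p that B \<open>0 \<in> B\<close>] u k by simp
          then have "(u, k, 0) \<in> E"
            using \<open>odd u\<close> \<open>u < k\<close> False m u k lp_bound[OF p B]
            by (simp add: E_def linial_edges_def)
          then show ?thesis
            using edge_flatD(2)[OF w, of u k 0] odd_zero[of u] u \<open>odd u\<close> by simp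
        qed
        with ij show ?thesis by simp
      next
        case nz: False
        have edge: "gain m (snd p) a * w a = gain m (snd p) b * w b"
          if ab: "a \<in> B" "b \<in> B" "odd a" "even b" "a < b" for a b
        proof -
          have "(gain m (snd p) b / gain m (snd p) a) ^ m = 1"
            using m by (simp add: power_divide gain_power)
          then obtain l where l: "l < m" "gain m (snd p) b / gain m (snd p) a = unity_root m ^ l"
            using unity_root_power_surj m by blast
          have "v a = unity_root m ^ l * v b" if "v \<in> flat m p" for v
            using flatD[OF that B ab(1,2)] l by (simp add: gain_nonzero field_simps flip: l(2))
          then have "(a, b, l) \<in> E"
            using ab l lp_bound[OF p B] by (auto simp: E_def linial_edges_def)
          then show ?thesis
            using edge_flatD(2)[OF w, of a b l] by (simp add: gain_nonzero flip: l(2))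
        qed
        show ?thesis
        proof (cases "is_singleton B")
          case True
          with ij show ?thesis
            by (auto simp: is_singleton_def)
        next
          case False
          then have odd: "odd (Min B)" and even: "even (Max B)"
            using lin B nz by (auto simp: linial_partition_def)
          have mm: "Min B \<in> B" "Max B \<in> B"
            using fin ij by (auto intro: Min_in Max_in)
          have "gain m (snd p) k * w k = gain m (snd p) (Max B) * w (Max B)" if k: "k \<in> B" for k
          proof -
            have le: "Min B \<le> k" "k \<le> Max B"
              using k fin by auto
            show ?thesis
            proof (cases "odd k")
              case True
              with le even have "k < Max B" by (metis le_neq_implies_less)
              with True show ?thesis
                using edge k mm even by blast
            next
              case False
              with le odd have "Min B < k" by (metis le_neq_implies_less)
              then have "gain m (snd p) (Min B) * w (Min B) = gain m (snd p) k * w k"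
                using edge k mm odd False by blast
              moreover have "gain m (snd p) (Min B) * w (Min B) = gain m (snd p) (Max B) * w (Max B)"
                using edge mm odd even \<open>Min B < k\<close> le(2) by (meson less_le_trans)
              ultimately show ?thesis by simp
            qed
          qed
          then show ?thesis
            using ij by simp
        qed
      qed
    qed
  qed
  ultimately show ?thesis
    using sub by blast
qed

text \<open>
  The blocks are the classes of coordinates that are proportional on the whole flat. If a positive
  \<open>k\<close> were in no equation of \<open>E\<close>, then the flat would contain the \<open>k\<close>-th unit vector, so that \<open>k\<close>
  would form a block of its own. As even elements have only smaller neighbours and odd
  ones only larger neighbours or \<open>0\<close>, this gives the parity conditions.
\<close>

lemma edge_flat_eq_flat:
  assumes m: "m > 0" and E: "E \<subseteq> linial_edges N m"
  shows "\<exists>p\<in>labeled_partitions N m. linial_partition p \<and> flat m p = edge_flat m E"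
proof -
  define F where "F = edge_flat m E"
  \<comment> \<open>Factors of proportionality are restricted to \<open>m\<close>-th roots of unity
    so that they can be written as labels. The class of \<open>0\<close> consists of the coordinates
    vanishing on \<open>F\<close>.\<close>
  define R where
    "R = {(i, j). i \<le> N \<and> j \<le> N \<and> (\<exists>r. r ^ m = 1 \<and> (\<forall>w\<in>F. w i = r * w j))}"
  define van where "van i \<longleftrightarrow> (\<forall>w\<in>F. w i = 0)" for i
  define P where "P = {0..N} // R"
  have F0: "w 0 = 0" if "w \<in> F" for w
    using that edge_flatD(1) unfolding F_def by blast
  have sym: "(j, i) \<in> R" if ij: "(i, j) \<in> R" for i j
  proof -
    obtain r where r: "r ^ m = 1" "\<forall>w\<in>F. w i = r * w j" and "i \<le> N" "j \<le> N"
      using ij unfolding R_def by blast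
    moreover have "r \<noteq> 0" using r m by (auto simp: power_0_left)
    ultimately show ?thesis
      by (auto simp: R_def power_inverse field_simps intro!: exI[of _ "inverse r"])
  qed
  have equiv: "equiv {0..N} R"
  proof (rule equivI)
    show "R \<subseteq> {0..N} \<times> {0..N}" by (auto simp: R_def)
    show "refl_on {0..N} R" by (auto simp: R_def refl_on_def intro!: exI[of _ 1])
    show "sym R" using sym by (rule symI)
    show "trans R"
    proof (rule transI)
      fix i j k assume "(i, j) \<in> R" "(j, k) \<in> R"
      then obtain r s where "r ^ m = 1" "\<forall>w\<in>F. w i = r * w j" "s ^ m = 1" "\<forall>w\<in>F. w j = s * w k"
        and "i \<le> N" "k \<le> N"
        unfolding R_def by blast
      then show "(i, k) \<in> R"
        by (auto simp: R_def power_mult_distrib intro!: exI[of _ "r * s"])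
    qed
  qed
  have part: "partition_on {0..N} P"
    unfolding P_def by (rule partition_on_quotient[OF equiv])
  have cls: "B = R `` {i}" if "B \<in> P" "i \<in> B" for B i
    using that unfolding P_def
    by (metis Image_singleton_iff equiv equiv_class_eq_iff quotientE)
  have mem: "j \<in> B \<longleftrightarrow> (i, j) \<in> R" if "B \<in> P" "i \<in> B" for B i j
    using cls[OF that] by blast
  have blk: "finite B" "B \<noteq> {}" "B \<subseteq> {0..N}" if "B \<in> P" for B
    using part that unfolding partition_on_def
    by (metis Union_upper finite_atLeastAtMost finite_subset)+
  have cover: "\<exists>B\<in>P. i \<in> B" if "i \<le> N" for i
  proof -
    have "i \<in> \<Union>P"
      using part that by (simp add: partition_on_def)
    then show ?thesis by blast
  qed
  have zero: "i \<in> B \<longleftrightarrow> i \<le> N \<and> van i" if "B \<in> P" "0 \<in> B" for B i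
  proof -
    have "(i, 0) \<in> R \<longleftrightarrow> i \<le> N \<and> van i"
      using F0 by (auto simp: R_def van_def intro!: exI[of _ 1])
    then show ?thesis
      using mem[OF that] sym by blast
  qed
  have nonzero: "\<not> van i" if B: "B \<in> P" "0 \<notin> B" "i \<in> B" for B i
  proof
    assume "van i"
    then have "(i, 0) \<in> R"
      using F0 blk(3)[OF B(1)] B(3) by (auto simp: R_def van_def intro!: exI[of _ 1])
    then show False
      using mem[OF B(1,3)] B(2) by blast
  qed
  \<comment> \<open>The label is an exponent of a factor from \<open>w i\<close> to the value at the
    minimum of the class of \<open>i\<close>, which makes the label of the minimum \<open>0\<close>.
    Vanishing coordinates form the zero block and stay unlabeled.\<close>
  define lab where "lab = (\<lambda>i. if i \<le> N \<and> \<not> van i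
    then Some (SOME l. l < m \<and> (\<forall>w\<in>F. unity_root m ^ l * w i = w (Min (R `` {i})))) else None)"
  have lab_ex: "\<exists>l<m. lab i = Some l \<and> (\<forall>w\<in>F. unity_root m ^ l * w i = w (Min B))"
    if B: "B \<in> P" "0 \<notin> B" "i \<in> B" for B i
  proof -
    have "Min B \<in> B"
      using blk[OF B(1)] by simp
    then have "(Min B, i) \<in> R"
      using mem B sym by blast
    then obtain r where r: "r ^ m = 1" "\<forall>w\<in>F. w (Min B) = r * w i"
      by (auto simp: R_def)
    then obtain l where "l < m" "r = unity_root m ^ l"
      using unity_root_power_surj m by blast
    with r have "\<exists>l. l < m \<and> (\<forall>w\<in>F. unity_root m ^ l * w i = w (Min B))"
      by auto
    from someI_ex[OF this] show ?thesis
      using nonzero[OF B] blk(3)[OF B(1)] B(3) cls[OF B(1,3)] by (auto simp: lab_def)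
  qed
  have gain_F: "gain m lab i * w i = w (Min B)"
    if B: "B \<in> P" "0 \<notin> B" "i \<in> B" and w: "w \<in> F" for B i w
    using lab_ex[OF B] w by (auto simp: gain_def)
  have lab_Min: "lab (Min B) = Some 0" if B: "B \<in> P" "0 \<notin> B" for B
  proof -
    have MB: "Min B \<in> B"
      using blk[OF B(1)] by simp
    obtain l where l: "l < m" "lab (Min B) = Some l"
      "\<forall>w\<in>F. unity_root m ^ l * w (Min B) = w (Min B)"
      using lab_ex[OF B MB] by blast
    obtain w where "w \<in> F" "w (Min B) \<noteq> 0"
      using nonzero[OF B MB] by (auto simp: van_def)
    with l have "unity_root m ^ l = unity_root m ^ 0"
      by auto
    then show ?thesis
      using unity_root_power_inj[of m l 0] l m by simp
  qed
  have dom: "dom lab = \<Union>{B \<in> P. 0 \<notin> B}"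
  proof (rule Set.set_eqI)
    fix i
    have "i \<in> dom lab \<longleftrightarrow> i \<le> N \<and> \<not> van i"
      by (simp add: lab_def domIff)
    also have "\<dots> \<longleftrightarrow> (\<exists>B\<in>P. 0 \<notin> B \<and> i \<in> B)"
      using cover[of i] zero nonzero blk(3) by (metis atLeastAtMost_iff subsetD)
    finally show "i \<in> dom lab \<longleftrightarrow> i \<in> \<Union>{B \<in> P. 0 \<notin> B}"
      by blast
  qed
  have ran: "ran lab \<subseteq> {..<m}"
  proof
    fix a assume "a \<in> ran lab"
    then obtain i where i: "lab i = Some a"
      by (auto simp: ran_def)
    then have "i \<in> dom lab" by auto
    then obtain B where "B \<in> P" "0 \<notin> B" "i \<in> B"
      using dom by auto
    from lab_ex[OF this] i show "a \<in> {..<m}" by auto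
  qed
  have lp: "(P, lab) \<in> labeled_partitions N m"
    using part dom ran lab_Min by (simp add: labeled_partitions_def)
  have edge: "j \<in> B \<longleftrightarrow> i \<in> B" if "(i, j, l) \<in> E" "B \<in> P" for i j l B
  proof -
    have "i \<le> N" "j \<le> N"
      using E that by (auto simp: linial_edges_def)
    then have "(i, j) \<in> R"
      using edge_flatD(2)[OF _ that(1)] unity_root_power_self[OF m]
      by (auto simp: R_def F_def)
    then show ?thesis
      using mem[OF that(2)] sym by blast
  qed
  have "F \<subseteq> flat m (P, lab)"
  proof
    fix w assume w: "w \<in> F"
    show "w \<in> flat m (P, lab)"
    proof (rule flatI)
      fix B i j assume B: "B \<in> fst (P, lab)" and ij: "i \<in> B" "j \<in> B"
      show "gain m (snd (P, lab)) i * w i = gain m (snd (P, lab)) j * w j"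
      proof (cases "0 \<in> B")
        case True
        then have "w i = 0" "w j = 0"
          using zero[of B] B ij w by (auto simp: van_def)
        then show ?thesis by simp
      next
        case False
        then show ?thesis
          using gain_F[of B _ w] B ij w by simp
      qed
    qed (rule F0[OF w])
  qed
  moreover have "flat m (P, lab) \<subseteq> F"
    unfolding F_def
  proof
    fix w assume w: "w \<in> flat m (P, lab)"
    show "w \<in> edge_flat m E"
    proof (rule edge_flatI)
      fix i j l assume e: "(i, j, l) \<in> E"
      then obtain B where B: "B \<in> P" "i \<in> B"
        using E cover[of i] by (auto simp: linial_edges_def)
      then have j: "j \<in> B"
        using edge[OF e] by blast
      show "w i = unity_root m ^ l * w j"
      proof (cases "0 \<in> B")
        case True
        then show ?thesis
          using flat_zero_block[OF lp w _ True] B j by simp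
      next
        case False
        \<comment> \<open>Cancelling the nonzero value \<open>v j\<close> shows that the factor of
          the edge is the quotient of the gains of \<open>j\<close> and \<open>i\<close>, so the
          block equation implies the edge equation.\<close>
        obtain v where v: "v \<in> F" "v j \<noteq> 0"
          using nonzero[OF B(1) False j] by (auto simp: van_def)
        have "gain m lab i * (unity_root m ^ l * v j) = gain m lab j * v j"
          using gain_F[OF B(1) False B(2) v(1)] gain_F[OF B(1) False j v(1)]
            edge_flatD(2)[OF v(1)[unfolded F_def] e] by simp
        with v have "gain m lab j = gain m lab i * unity_root m ^ l"
          by simp
        then show ?thesis
          using flatD[OF w, of B i j] B j gain_nonzero[of m lab i] by simp
      qed
    qed (rule flat_0[OF w])
  qed
  moreover have "linial_partition (P, lab)"
  proof -
    have ex: "\<exists>i j l. (i, j, l) \<in> E \<and> (i = k \<or> j = k)"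
      if B: "B \<in> P" "k \<in> B" "k \<noteq> 0" "B \<noteq> {k}" for B k
    proof (rule ccontr)
      assume no: "\<not> ?thesis"
      let ?w = "\<lambda>x. if x = k then 1 else 0"
      have "?w \<in> F"
        unfolding F_def by (rule edge_flatI) (use B no in auto)
      moreover obtain x where x: "x \<in> B" "x \<noteq> k"
        using B by blast
      moreover obtain r where "\<forall>w\<in>F. w k = r * w x"
        using mem[OF B(1,2), of x] x by (auto simp: R_def)
      ultimately show False
        by fastforce
    qed
    have below: "\<exists>i\<in>B. 0 < i \<and> i < k"
      if B: "B \<in> P" "k \<in> B" "k \<noteq> 0" "B \<noteq> {k}" "even k" for B k
    proof -
      obtain i j l where e: "(i, j, l) \<in> E" "i = k \<or> j = k"
        using ex B by blast
      then have "odd i" "j = 0 \<or> i < j"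
        using E by (auto simp: linial_edges_def)
      with e B edge[OF e(1) B(1)] show ?thesis
        by (metis odd_pos)
    qed
    have above: "0 \<in> B \<or> (\<exists>j\<in>B. k < j)"
      if B: "B \<in> P" "k \<in> B" "B \<noteq> {k}" "odd k" for B k
    proof -
      have "k \<noteq> 0" using B(4) by (metis even_zero)
      then obtain i j l where e: "(i, j, l) \<in> E" "i = k \<or> j = k"
        using ex B by blast
      then have "even j" "j = 0 \<or> i < j"
        using E by (auto simp: linial_edges_def)
      with e B edge[OF e(1) B(1)] show ?thesis
        by metis
    qed
    have "odd (Min (B - {0}))" if B: "B \<in> P" "0 \<in> B" "B \<noteq> {0}" for B
    proof
      define k where "k = Min (B - {0})"
      assume "even (Min (B - {0}))"
      then have "even k" by (simp add: k_def)
      moreover have k: "k \<in> B - {0}"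
        unfolding k_def using blk(1)[OF B(1)] B by (intro Min_in) auto
      ultimately obtain i where "i \<in> B" "0 < i" "i < k"
        using below[OF B(1), of k] B(2) by blast
      moreover from this have "Min (B - {0}) \<le> i"
        using blk(1)[OF B(1)] by (intro Min_le) auto
      ultimately show False
        by (simp add: k_def)
    qed
    moreover have "odd (Min B) \<and> even (Max B)"
      if B: "B \<in> P" "0 \<notin> B" "\<not> is_singleton B" for B
    proof (intro conjI)
      have fin: "finite B" and M: "Min B \<in> B" "Max B \<in> B"
        using blk[OF B(1)] by (auto intro: Min_in Max_in)
      have ns: "B \<noteq> {k}" for k
        using B(3) by auto
      show "odd (Min B)"
        using below[OF B(1) M(1) _ ns] M(1) B(2) Min_le[OF fin] by (metis not_less)
      show "even (Max B)"
        using above[OF B(1) M(2) ns] B(2) Max_ge[OF fin] by (metis not_less)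
    qed
    ultimately show ?thesis
      by (auto simp: linial_partition_def)
  qed
  ultimately show ?thesis
    using lp unfolding F_def by blast
qed

section \<open>The change of coordinates\<close>

text \<open>
  The coordinate \<open>x\<^sub>1\<close>, which would have index \<open>0\<close>, is not needed to write the equations, so that
  index \<open>0\<close> can stand for the zero block.
\<close>

definition dowling_coord :: "nat \<Rightarrow> complex vec \<Rightarrow> nat \<Rightarrow> complex" where
  "dowling_coord n v k =
     (if k = 0 then 0
      else if odd k then x_coord v (Suc k div 2) - y_coord n v (Suc k div 2)
      else x_coord v (Suc (k div 2)))"

lemma dowling_coord_surj:
  assumes "n \<ge> 1" "w 0 = 0"
  shows "\<exists>v\<in>carrier_vec (2 * n). \<forall>k\<le>2 * n - 1. dowling_coord n v k = w k"
proof
  \<comment> \<open>The even entries of \<open>w\<close> give the \<open>x\<close>-coordinates, with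
    \<open>x\<^sub>1\<close> receiving \<open>w 0 = 0\<close>; each \<open>y\<close>-coordinate is
    the \<open>x\<close>-coordinate minus the following odd entry.\<close>
  let ?v = "vec (2 * n) (\<lambda>t. if t < n then w (2 * t) else w (2 * (t - n)) - w (2 * (t - n) + 1))"
  show "?v \<in> carrier_vec (2 * n)" by simp
  show "\<forall>k\<le>2 * n - 1. dowling_coord n ?v k = w k"
  proof (intro allI impI)
    fix k assume k: "k \<le> 2 * n - 1"
    show "dowling_coord n ?v k = w k"
    proof (cases "even k")
      case True
      then obtain s where "k = 2 * s" by (rule evenE)
      moreover from this k assms(1) have "s < n" by simp
      ultimately show ?thesis
        using assms(2) by (simp add: dowling_coord_def x_coord_def)
    next
      case False
      then obtain s where "k = 2 * s + 1" by (rule oddE)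
      moreover from this k assms(1) have "s < n" by simp
      ultimately show ?thesis
        using assms(2) by (simp add: dowling_coord_def x_coord_def y_coord_def)
    qed
  qed
qed

text \<open>The equation for \<open>i < j\<close> is the edge from \<open>2 * i - 1\<close> to
  \<open>2 * j - 2\<close>, and the first index is below the second exactly when
  \<open>i < j\<close>. The equation \<open>x\<^sub>i = y\<^sub>i\<close> is an edge to
  \<open>0\<close>, where all labels describe the same hyperplane.\<close>

lemma linial_arrangement_eq:
  assumes "n \<ge> 1" "m \<ge> 1"
  shows "linial_arrangement n m =
    (\<lambda>(i, j, l). {v \<in> carrier_vec (2 * n).
      dowling_coord n v i = unity_root m ^ l * dowling_coord n v j}) ` linial_edges (2 * n - 1) m"
    (is "_ = ?h ` ?E")
proof -
  have \<omega>: "exp (2 * of_real pi * \<i> / of_nat m) = unity_root m"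
    by (simp add: unity_root_def cis_conv_exp mult_ac)
  have odd_coord: "dowling_coord n v (2 * i - 1) = x_coord v i - y_coord n v i" if i: "i \<ge> 1" for v i
  proof -
    obtain s where "i = Suc s" using i not0_implies_Suc[of i] by auto
    then show ?thesis by (simp add: dowling_coord_def)
  qed
  have even_coord: "dowling_coord n v (2 * j - 2) = x_coord v j" if j: "j \<ge> 2" for v j
  proof -
    obtain s where "j = Suc (Suc s)" using j by (metis add_2_eq_Suc le_Suc_ex)
    then show ?thesis by (simp add: dowling_coord_def)
  qed
  have h_edge: "?h (2 * i - 1, 2 * j - 2, l) =
      {v \<in> carrier_vec (2 * n). x_coord v i - unity_root m ^ l * x_coord v j = y_coord n v i}"
    if "1 \<le> i" "i < j" for i j l
  proof -
    have "j \<ge> 2" using that by simp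
    then show ?thesis
      unfolding case_prod_conv odd_coord[OF that(1)] even_coord[OF \<open>j \<ge> 2\<close>]
      by (auto simp: algebra_simps)
  qed
  have h_zero: "?h (2 * i - 1, 0, l) = {v \<in> carrier_vec (2 * n). x_coord v i = y_coord n v i}"
    if "1 \<le> i" for i l
    using odd_coord[OF that] by (auto simp: dowling_coord_def[of n _ 0])
  show ?thesis
  proof
    show "linial_arrangement n m \<subseteq> ?h ` ?E"
    proof
      fix H assume "H \<in> linial_arrangement n m"
      then consider i j l where "1 \<le> i" "i < j" "j \<le> n" "l < m"
          "H = {v \<in> carrier_vec (2 * n). x_coord v i - unity_root m ^ l * x_coord v j = y_coord n v i}"
        | i where "1 \<le> i" "i \<le> n" "H = {v \<in> carrier_vec (2 * n). x_coord v i = y_coord n v i}"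
        unfolding linial_arrangement_def Let_def \<omega> by blast
      then show "H \<in> ?h ` ?E"
      proof cases
        case 1
        then have "(2 * i - 1, 2 * j - 2, l) \<in> ?E"
          by (auto simp: linial_edges_def)
        then show ?thesis
          using h_edge[OF 1(1,2)] 1(5) by blast
      next
        case 2
        then have "(2 * i - 1, 0, 0) \<in> ?E"
          using assms by (auto simp: linial_edges_def)
        then show ?thesis
          using h_zero[OF 2(1)] 2(3) by blast
      qed
    qed
    show "?h ` ?E \<subseteq> linial_arrangement n m"
    proof (rule image_subsetI)
      fix e assume e: "e \<in> ?E"
      then obtain a b l where abl: "e = (a, b, l)" "odd a" "a \<le> 2 * n - 1" "even b" "b \<le> 2 * n - 1"
        "b = 0 \<or> a < b" "l < m"
        by (auto simp: linial_edges_def)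
      from abl obtain s t where st: "a = 2 * s + 1" "b = 2 * t"
        by (meson evenE oddE)
      show "?h e \<in> linial_arrangement n m"
      proof (cases "b = 0")
        case True
        then have "?h e = {v \<in> carrier_vec (2 * n). x_coord v (Suc s) = y_coord n v (Suc s)}"
          using h_zero[of "Suc s" l] abl st by simp
        moreover have "Suc s \<le> n"
          using abl st assms by simp
        ultimately show ?thesis
          unfolding linial_arrangement_def Let_def \<omega> by fastforce
      next
        case False
        then have "Suc s < Suc t" "Suc t \<le> n"
          using abl st assms by simp_all
        moreover from this have "?h e = {v \<in> carrier_vec (2 * n).
            x_coord v (Suc s) - unity_root m ^ l * x_coord v (Suc t) = y_coord n v (Suc s)}"
          using h_edge[of "Suc s" "Suc t" l] abl st by simp
        ultimately show ?thesis
          using abl(7) unfolding linial_arrangement_def Let_def \<omega>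
          by (intro UnI1 CollectI exI[of _ "Suc s"] exI[of _ "Suc t"] exI[of _ l]) simp
      qed
    qed
  qed
qed

lemma carrier_intersection_lattice_linial:
  assumes "n \<ge> 1" "m \<ge> 1"
  shows "carrier (intersection_lattice (carrier_vec (2 * n)) (linial_arrangement n m)) =
    (\<lambda>E. {v \<in> carrier_vec (2 * n). dowling_coord n v \<in> edge_flat m E}) ` Pow (linial_edges (2 * n - 1) m)"
    (is "?L = ?g ` Pow ?T")
proof -
  define g where "g = ?g"
  let ?h = "\<lambda>(i, j, l). {v \<in> carrier_vec (2 * n).
      dowling_coord n v i = unity_root m ^ l * dowling_coord n v j}"
  have inter: "carrier_vec (2 * n) \<inter> \<Inter>(?h ` E) = g E" for E
    by (auto simp: g_def edge_flat_def dowling_coord_def[of n _ 0])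
  \<comment> \<open>The arrangement is central: all hyperplanes contain the points whose coordinates
    \<open>dowling_coord\<close> vanish up to \<open>2 * n - 1\<close>.\<close>
  have ne: "g E \<noteq> {}" if "E \<subseteq> ?T" for E
  proof -
    obtain v where v: "v \<in> carrier_vec (2 * n)" "\<forall>k\<le>2 * n - 1. dowling_coord n v k = 0"
      using dowling_coord_surj[OF assms(1), of "\<lambda>_. 0"] by auto
    have "dowling_coord n v \<in> edge_flat m E"
      by (rule edge_flatI) (use v that in \<open>auto simp: linial_edges_def\<close>)
    with v show ?thesis unfolding g_def by blast
  qed
  have mem: "X \<in> ?L \<longleftrightarrow> X \<noteq> {} \<and> (\<exists>E\<subseteq>?T. X = carrier_vec (2 * n) \<inter> \<Inter>(?h ` E))" for X
    unfolding intersection_lattice_def linial_arrangement_eq[OF assms]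
    by (auto simp: subset_image_iff)
  have "?L = g ` Pow ?T"
  proof (rule Set.set_eqI)
    fix X
    show "X \<in> ?L \<longleftrightarrow> X \<in> g ` Pow ?T"
      unfolding mem inter image_iff Bex_def Pow_iff using ne by metis
  qed
  then show ?thesis
    by (simp only: g_def)
qed

section \<open>Assembling the isomorphism\<close>

lemma partial_order_subset:
  assumes "partial_order L" "A \<subseteq> carrier L"
  shows "partial_order (L\<lparr>carrier := A\<rparr>)"
proof -
  interpret partial_order L by fact
  show ?thesis
    by unfold_locales (use assms(2) in \<open>auto simp: subset_iff eq_is_equal intro: le_trans le_antisym\<close>)
qed

theorem theorem4p2:
  fixes n m :: nat
  assumes "n \<ge> 1" and "m \<ge> 1"
  shows "poset_isomorphic
    (intersection_lattice (carrier_vec (2 * n)) (linial_arrangement n m))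
    (linial_subposet n m)"
proof -
  let ?N = "2 * n - 1"
  let ?A = "intersection_lattice (carrier_vec (2 * n)) (linial_arrangement n m)"
  let ?D = "dowling_lattice ?N m" and ?B = "linial_subposet n m"
  define g where "g p = {v \<in> carrier_vec (2 * n). dowling_coord n v \<in> flat m p}" for p
  have m: "m > 0" using assms by simp
  have B: "carrier ?B = {p \<in> labeled_partitions ?N m. linial_partition p}"
    by (simp add: linial_subposet_def dowling_lattice_def)
  have leB: "p \<sqsubseteq>\<^bsub>?B\<^esub> q \<longleftrightarrow> (dowling_merge m)\<^sup>*\<^sup>* p q" for p q
    by (simp add: linial_subposet_def dowling_lattice_def)
  have poB: "partial_order ?B"
    unfolding linial_subposet_def
    by (intro partial_order_subset partial_order_dowling_lattice) auto
  have sub_iff: "g q \<subseteq> g p \<longleftrightarrow> flat m q \<subseteq> flat m p"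
    if p: "p \<in> labeled_partitions ?N m" and q: "q \<in> labeled_partitions ?N m" for p q
  proof
    assume sub: "g q \<subseteq> g p"
    show "flat m q \<subseteq> flat m p"
    proof
      fix w assume w: "w \<in> flat m q"
      \<comment> \<open>Some point has coordinates agreeing with \<open>w\<close> up to
        \<open>?N\<close>; \<open>flat_cong\<close> passes from \<open>w\<close> to these
        coordinates for \<open>q\<close> and back for \<open>p\<close>.\<close>
      obtain v where v: "v \<in> carrier_vec (2 * n)" "\<And>k. k \<le> ?N \<Longrightarrow> dowling_coord n v k = w k"
        using dowling_coord_surj[of n w] assms flat_0[OF w] by auto
      have "dowling_coord n v \<in> flat m q"
        by (rule flat_cong[OF q _ w]) (simp add: v)
      then have "dowling_coord n v \<in> flat m p"
        using sub v by (auto simp: g_def)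
      from flat_cong[OF p _ this] show "w \<in> flat m p"
        using v by blast
    qed
  qed (auto simp: g_def)
  have emb: "g p \<sqsubseteq>\<^bsub>?A\<^esub> g q \<longleftrightarrow> p \<sqsubseteq>\<^bsub>?B\<^esub> q" if "p \<in> carrier ?B" "q \<in> carrier ?B" for p q
    using that B sub_iff[of p q] dowling_le_iff_flat[OF m, of p ?N q]
    by (auto simp: leB intersection_lattice_def)
  have inj: "inj_on g (carrier ?B)"
  proof (rule inj_onI)
    fix p q assume pq: "p \<in> carrier ?B" "q \<in> carrier ?B" "g p = g q"
    interpret partial_order ?B by (rule poB)
    have "p \<sqsubseteq>\<^bsub>?B\<^esub> q" "q \<sqsubseteq>\<^bsub>?B\<^esub> p"
      using pq emb[of p q] emb[of q p] by (auto simp: intersection_lattice_def)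
    with pq show "p = q"
      using le_antisym by (simp add: eq_is_equal)
  qed
  have flats: "flat m ` carrier ?B = edge_flat m ` Pow (linial_edges ?N m)"
  proof
    show "flat m ` carrier ?B \<subseteq> edge_flat m ` Pow (linial_edges ?N m)"
      using flat_eq_edge_flat[OF m, of _ ?N] unfolding B by blast
    show "edge_flat m ` Pow (linial_edges ?N m) \<subseteq> flat m ` carrier ?B"
    proof (rule image_subsetI)
      fix E assume "E \<in> Pow (linial_edges ?N m)"
      then obtain p where "p \<in> carrier ?B" "flat m p = edge_flat m E"
        using edge_flat_eq_flat[OF m, of E ?N] by (auto simp: B)
      then show "edge_flat m E \<in> flat m ` carrier ?B"
        by (metis imageI)
    qed
  qed
  \<comment> \<open>Preimages under the coordinate map are taken in two equal families: one gives
    the image of \<open>g\<close>, the other all intersections of hyperplanes.\<close>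
  have "g ` carrier ?B = carrier ?A"
    using arg_cong[OF flats, of "image (\<lambda>X. {v \<in> carrier_vec (2 * n). dowling_coord n v \<in> X})"]
    unfolding carrier_intersection_lattice_linial[OF assms] g_def image_image .
  with inj have "bij_betw g (carrier ?B) (carrier ?A)"
    by (simp add: bij_betw_def)
  then show ?thesis
    by (rule poset_isomorphicI[OF partial_order_intersection_lattice poB _ emb])
qed

end
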